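(* There exist numbers $\alpha_n\in(0,1)$ and nonempty compact sets $E_n\subset\mathbb C$ ($n\in\mathbb N$) such that each $E_n$ is $\alpha_n$-uniformly perfect, $E_n$ converges to the unit circle $\mathbb T=\{z\in\mathbb C:|z|=1\}$ in the Hausdorff metric, and the sequence $d_H(E_n,\mathbb T)\log\alpha_n$ is bounded, yet the Green's functions $g_{E_n}$ do not converge to $g_{\mathbb T}$ uniformly on $\mathbb C$.
   Context: Uniformly perfect: for $\alpha\in(0,1)$, a closed set $E\subset\mathbb C$ is $\alpha$-uniformly perfect if the set $E\cap\{z:\alpha r\le|z-a|\le r\}$ is nonempty for every $a\in E$ and every $r$ with $0<r\le\operatorname{diam}E$. Hausdorff distance between nonempty bounded closed sets: $d_H(A,B)=\max\left(\sup_{z\in A}\inf_{t\in B}|z-t|,\ \sup_{z\in B}\inf_{t\in A}|z-t|\right)$. Green's function: for compact $E\subset\mathbb C$ of positive logarithmic capacity, let $\Omega$ be the component of $\overline{\mathbb C}\setminus E$ containing $\infty$. Then $g_E$ is Green's function of $\Omega$ with pole at $\infty$: it is harmonic in $\Omega\setminus\{\infty\}$, $g_E(z)=\log|z|+O(1)$ as $z\to\infty$, it is zero on $\mathbb C\setminus\Omega$, and it is continuous on $\mathbb C$ (for general non-polar $E$ the continuity is allowed to fail on a polar subset of $\partial\Omega$). *)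

theory Defs
  imports "HOL-Analysis.Analysis" "HOL-Library.Landau_Symbols"
begin

section \<open>Uniformly perfect sets and the Hausdorff distance\<close>

text \<open>
  The diameter of an unbounded set is infinite, but the library's \<open>diameter\<close> is a real number
  without a meaningful value there; hence the guard \<open>bounded E\<close>.
\<close>

definition uniformly_perfect :: "real \<Rightarrow> complex set \<Rightarrow> bool" where
  "uniformly_perfect \<alpha> E \<longleftrightarrow> 0 < \<alpha> \<and> \<alpha> < 1 \<and> closed E \<and>
     (\<forall>a\<in>E. \<forall>r. 0 < r \<and> (bounded E \<longrightarrow> r \<le> diameter E) \<longrightarrow>
        E \<inter> {z. \<alpha> * r \<le> cmod (z - a) \<and> cmod (z - a) \<le> r} \<noteq> {})"

text \<open>Meaningful for nonempty bounded sets, where \<open>infdist z B\<close> is the infimum of the distances.\<close>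

definition hausdorff_distance :: "complex set \<Rightarrow> complex set \<Rightarrow> real" where
  "hausdorff_distance A B = max (SUP z\<in>A. infdist z B) (SUP z\<in>B. infdist z A)"

section \<open>Logarithmic capacity\<close>

text \<open>The case distinction is needed because \<open>ln 0 = 0\<close> in the library.\<close>

definition log_kernel :: "complex \<Rightarrow> complex \<Rightarrow> ereal" where
  "log_kernel z w = (if z = w then \<infinity> else ereal (ln (1 / cmod (z - w))))"

text \<open>
  The energy is the double integral of \<open>log_kernel\<close>, split into its positive and negative parts
  (\<open>e2ennreal\<close> sends negative numbers to 0). For a finite measure with compact support the second
  integral is finite.
\<close>

definition log_energy :: "complex measure \<Rightarrow> ereal" where
  "log_energy \<mu> =
     enn2ereal (\<integral>\<^sup>+ z. (\<integral>\<^sup>+ w. e2ennreal (log_kernel z w) \<partial>\<mu>) \<partial>\<mu>)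
   - enn2ereal (\<integral>\<^sup>+ z. (\<integral>\<^sup>+ w. e2ennreal (- log_kernel z w) \<partial>\<mu>) \<partial>\<mu>)"

definition compactly_supported_probs :: "complex set \<Rightarrow> complex measure set" where
  "compactly_supported_probs E =
     {\<mu>. sets \<mu> = sets borel \<and> emeasure \<mu> (space \<mu>) = 1 \<and>
         (\<exists>K. compact K \<and> K \<subseteq> E \<and> emeasure \<mu> (- K) = 0)}"

definition robin_constant :: "complex set \<Rightarrow> ereal" where
  "robin_constant E = (INF \<mu>\<in>compactly_supported_probs E. log_energy \<mu>)"

text \<open>The logarithmic capacity is \<open>exp (- V)\<close>, with \<open>V\<close> the Robin constant in the extended reals.\<close>

definition log_capacity :: "complex set \<Rightarrow> ennreal" where
  "log_capacity E =
     (if robin_constant E = \<infinity> then 0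
      else if robin_constant E = - \<infinity> then \<infinity>
      else ennreal (exp (- real_of_ereal (robin_constant E))))"

definition polar :: "complex set \<Rightarrow> bool" where
  "polar E \<longleftrightarrow> log_capacity E = 0"

section \<open>Harmonic functions and Green's function\<close>

text \<open>
  \<open>p\<close>, \<open>q\<close> are the first partial derivatives with respect to the real and imaginary parts;
  \<open>pp\<close>, \<open>pq\<close>, \<open>qp\<close>, \<open>qq\<close> are the second ones. So \<open>u\<close> is twice continuously differentiable and
  satisfies Laplace's equation.
\<close>

definition harmonic_on :: "(complex \<Rightarrow> real) \<Rightarrow> complex set \<Rightarrow> bool" where
  "harmonic_on u S \<longleftrightarrow> open S \<and>
     (\<exists>p q pp pq qp qq :: complex \<Rightarrow> real.
        (\<forall>z\<in>S.
           (u has_derivative (\<lambda>h. p z * Re h + q z * Im h)) (at z) \<and>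
           (p has_derivative (\<lambda>h. pp z * Re h + pq z * Im h)) (at z) \<and>
           (q has_derivative (\<lambda>h. qp z * Re h + qq z * Im h)) (at z) \<and>
           pp z + qq z = 0) \<and>
        continuous_on S pp \<and> continuous_on S pq \<and> continuous_on S qp \<and> continuous_on S qq)"

text \<open>
  For compact \<open>E\<close>, the library's \<open>outside E\<close> is the unbounded component of the complement, that is,
  the component \<open>\<Omega>\<close> of the complement of \<open>E\<close> in the Riemann sphere that contains \<open>\<infinity>\<close>, with the
  point \<open>\<infinity>\<close> removed.

  Continuity may fail on a polar set \<open>P\<close> of boundary points, which is empty when \<open>\<Omega>\<close> is regular
  for the Dirichlet problem. Local boundedness is automatic if \<open>P\<close> is empty; otherwise it is the
  usual requirement that makes Green's function unique (it excludes, for instance, adding a Poisson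
  kernel with pole at a point of \<open>P\<close>).
\<close>

definition green_function :: "complex set \<Rightarrow> (complex \<Rightarrow> real) \<Rightarrow> bool" where
  "green_function E g \<longleftrightarrow>
     compact E \<and> log_capacity E > 0 \<and>
     harmonic_on g (outside E) \<and>
     (\<lambda>z. g z - ln (cmod z)) \<in> O[at_infinity](\<lambda>_. 1) \<and>
     (\<forall>z. z \<notin> outside E \<longrightarrow> g z = 0) \<and>
     (\<forall>R. bounded (g ` cball 0 R)) \<and>
     (\<exists>P. polar P \<and> P \<subseteq> frontier (outside E) \<and> (\<forall>z. z \<notin> P \<longrightarrow> isCont g z))"

end

theory Submission
  imports Defs "HOL-Complex_Analysis.Conformal_Mappings"
begin

text \<open>
  The sets are the lemniscates \<open>E = {z. cmod (z ^ N - 1) \<le> \<delta>}\<close> with \<open>\<delta> = (1 / 4) ^ N\<close>: exponentially small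
  continua around the \<open>N\<close>-th roots of unity. They are within \<open>7 / N\<close> of the unit circle, because the
  roots of unity are that dense. But \<open>E\<close> leaks: each component is so small that Green's function of
  \<open>E\<close>, which is \<open>ln (max 1 (cmod (z ^ N - 1) / \<delta>)) / N\<close>, has the value \<open>ln 4\<close> at the origin for every
  \<open>N\<close>, while Green's function of the circle vanishes there. A component of size about \<open>\<delta> / N\<close> in a
  bounded set makes \<open>E\<close> uniformly perfect with constant \<open>\<delta> / (8 * N)\<close>, whose logarithm is of order \<open>- N\<close>,
  so the product with the Hausdorff distance stays bounded. Thus the exponential rate in \<open>\<delta>\<close> is just
  slow enough for the boundedness and just fast enough for the leak.

  The formula for Green's function rests on the connectedness of the exterior of a lemniscate up to
  infinity, by the maximum principle (\<open>outside_lemniscate_disc\<close>), on the harmonicity of the logarithm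
  of the modulus of a holomorphic function (\<open>harmonic_on_ln_cmod_holomorphic\<close>), and on positive
  capacity, which comes from an arc in the set (\<open>log_capacity_pos_expanding_arc\<close>). Uniform
  perfectness comes from lifting segments through the \<open>N\<close>-th power
  (\<open>unity_lemniscate_meets_circle\<close>).
\<close>

section \<open>Sets of positive capacity\<close>

text \<open>
  The square root of the library is odd, so \<open>4 * sqrt (s - t)\<close> is an antiderivative on both sides of
  the singularity.
\<close>

lemma has_integral_inverse_sqrt_dist:
  fixes t :: real
  assumes "0 \<le> t" "t \<le> 1"
  shows "((\<lambda>s. 2 / sqrt \<bar>t - s\<bar>) has_integral 4 * (sqrt (1 - t) + sqrt t)) {0..1}"
proof -
  have "((\<lambda>s. 4 * sqrt (s - t)) has_vector_derivative 2 / sqrt \<bar>t - s\<bar>) (at s)"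
    if "s \<in> {0<..<1} - {t}" for s
  proof -
    from that have "s - t \<noteq> 0" by auto
    then have "DERIV sqrt (s - t) :> 1 / sqrt \<bar>t - s\<bar> / 2"
    proof (rule DERIV_real_sqrt_generic)
      assume "s - t < 0"
      then have "sqrt \<bar>t - s\<bar> = - sqrt (s - t)"
        using real_sqrt_minus[of "s - t"] by simp
      then show "1 / sqrt \<bar>t - s\<bar> / 2 = - inverse (sqrt (s - t)) / 2"
        by (simp add: inverse_eq_divide)
    qed (simp add: inverse_eq_divide)
    moreover have "((\<lambda>s. s - t) has_real_derivative 1) (at s)"
      by (auto intro!: derivative_eq_intros)
    ultimately have "((\<lambda>s. 4 * sqrt (s - t)) has_real_derivative 4 * (1 / sqrt \<bar>t - s\<bar> / 2 * 1)) (at s)"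
      by (intro DERIV_cmult DERIV_chain2)
    then show ?thesis
      by (simp add: has_real_derivative_iff_has_vector_derivative)
  qed
  moreover have "continuous_on {0..1} (\<lambda>s. 4 * sqrt (s - t))"
    by (intro continuous_intros)
  ultimately have "((\<lambda>s. 2 / sqrt \<bar>t - s\<bar>) has_integral 4 * sqrt (1 - t) - 4 * sqrt (0 - t)) {0..1}"
    by (intro fundamental_theorem_of_calculus_interior_strong[of "{t}"]) auto
  then show ?thesis by (simp add: real_sqrt_minus)
qed

text \<open>There is no probability measure on the empty set, so the infimum of the energies is \<open>\<infinity>\<close>.\<close>

lemma polar_empty: "polar {}"
proof -
  have "compactly_supported_probs {} = {}"
    by (auto simp: compactly_supported_probs_def dest: sets_eq_imp_space_eq)
  then show ?thesis
    by (simp add: polar_def log_capacity_def robin_constant_def top_ereal_def)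
qed

text \<open>
  The push-forward \<open>\<mu>\<close> of Lebesgue measure on the unit interval has finite energy: since
  \<open>ln (1 / x) \<le> 2 / sqrt x\<close>, the positive part of its kernel, integrated against \<open>\<mu>\<close> from the point
  \<open>\<gamma> t\<close>, is at most the integral of \<open>2 / sqrt (c * \<bar>t - s\<bar>)\<close> over \<open>s\<close>, which is bounded
  independently of \<open>t\<close>.
\<close>

lemma log_capacity_pos_expanding_arc:
  fixes \<gamma> :: "real \<Rightarrow> complex"
  assumes cont: "continuous_on {0..1} \<gamma>" and sub: "\<gamma> ` {0..1} \<subseteq> E" and "c > 0"
    and expand: "\<And>s t. s \<in> {0..1} \<Longrightarrow> t \<in> {0..1} \<Longrightarrow> c * \<bar>t - s\<bar> \<le> cmod (\<gamma> t - \<gamma> s)"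
  shows "log_capacity E > 0"
proof -
  define L where "L = restrict_space (lborel :: real measure) {0..1}"
  define \<mu> where "\<mu> = distr L borel \<gamma>"
  define K where "K = \<gamma> ` {0..1}"
  have cK: "compact K"
    unfolding K_def using cont by (rule compact_continuous_image) simp
  then have K_borel [measurable]: "K \<in> sets borel"
    by (simp add: compact_imp_closed)
  have spL: "space L = {0..1}" by (simp add: L_def space_restrict_space)
  have [measurable]: "\<gamma> \<in> measurable L borel"
    unfolding L_def using borel_measurable_continuous_on_restrict[OF cont]
    by (simp add: measurable_def space_restrict_space sets_restrict_space)
  have emL: "emeasure L (space L) = 1"
    unfolding spL by (simp add: L_def emeasure_restrict_space)
  have "emeasure \<mu> (- K) = emeasure L {}"
  proof -
    have "\<gamma> -` (- K) \<inter> space L = {}" by (auto simp: spL K_def)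
    then show ?thesis unfolding \<mu>_def by (subst emeasure_distr) auto
  qed
  moreover have "emeasure \<mu> (space \<mu>) = 1"
    unfolding \<mu>_def by (subst emeasure_distr) (use emL in auto)
  ultimately have prob: "\<mu> \<in> compactly_supported_probs E"
    using cK sub by (auto simp: compactly_supported_probs_def \<mu>_def K_def)
  define C where "C = ennreal (8 / sqrt c)"
  have inner: "(\<integral>\<^sup>+ w. e2ennreal (log_kernel z w) \<partial>\<mu>) \<le> C" if "z \<in> K" for z
  proof -
    from that obtain t where t: "t \<in> {0..1}" "z = \<gamma> t" by (auto simp: K_def)
    have [measurable]: "(\<lambda>w. e2ennreal (log_kernel z w)) \<in> borel_measurable borel"
      unfolding log_kernel_def by measurable
    have "(\<integral>\<^sup>+ w. e2ennreal (log_kernel z w) \<partial>\<mu>) = (\<integral>\<^sup>+ s. e2ennreal (log_kernel z (\<gamma> s)) \<partial>L)"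
      unfolding \<mu>_def by (rule nn_integral_distr) auto
    also have "\<dots> \<le> (\<integral>\<^sup>+ s. ennreal (2 / sqrt \<bar>t - s\<bar> / sqrt c) \<partial>L)"
    proof (rule nn_integral_mono_AE)
      have "AE s in L. s \<in> {0..1} \<and> s \<noteq> t"
        unfolding L_def by (subst AE_restrict_space_iff) (use AE_lborel_singleton[of t] in auto)
      then show "AE s in L. e2ennreal (log_kernel z (\<gamma> s)) \<le> ennreal (2 / sqrt \<bar>t - s\<bar> / sqrt c)"
      proof (rule AE_mp, intro AE_I2 impI)
        fix s assume s: "s \<in> {0..1} \<and> s \<noteq> t"
        define x where "x = cmod (\<gamma> t - \<gamma> s)"
        have x: "c * \<bar>t - s\<bar> \<le> x" using expand t s by (auto simp: x_def)
        moreover have "0 < c * \<bar>t - s\<bar>" using s \<open>c > 0\<close> by simp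
        ultimately have "x > 0" by linarith
        \<comment> \<open>Passing to the square root before using \<open>ln y \<le> y\<close> makes the bound integrable at \<open>s = t\<close>.\<close>
        have "ln (1 / x) = 2 * ln (1 / sqrt x)"
          using \<open>x > 0\<close> by (simp add: ln_div ln_sqrt)
        also have "\<dots> \<le> 2 * (1 / sqrt x)"
          using \<open>x > 0\<close> by (intro mult_left_mono ln_bound) auto
        also have "\<dots> \<le> 2 * (1 / sqrt (c * \<bar>t - s\<bar>))"
          using x \<open>x > 0\<close> \<open>0 < c * \<bar>t - s\<bar>\<close> by (intro mult_left_mono divide_left_mono) auto
        finally have "ln (1 / x) \<le> 2 / sqrt \<bar>t - s\<bar> / sqrt c"
          by (simp add: real_sqrt_mult mult.commute)
        moreover have "\<gamma> t \<noteq> \<gamma> s" using \<open>x > 0\<close> by (auto simp: x_def)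
        ultimately show "e2ennreal (log_kernel z (\<gamma> s)) \<le> ennreal (2 / sqrt \<bar>t - s\<bar> / sqrt c)"
          by (simp add: log_kernel_def t x_def ennreal_leI)
      qed
    qed
    also have "\<dots> = (\<integral>\<^sup>+ s. ennreal (2 / sqrt \<bar>t - s\<bar> / sqrt c) * indicator {0..1} s \<partial>lborel)"
      unfolding L_def by (subst nn_integral_restrict_space) auto
    also have "\<dots> = ennreal (4 * (sqrt (1 - t) + sqrt t) / sqrt c)"
      by (rule nn_integral_has_integral_lebesgue')
         (use t \<open>c > 0\<close> has_integral_divide[OF has_integral_inverse_sqrt_dist[of t], of "sqrt c"] in auto)
    also have "\<dots> \<le> C"
    proof -
      have "sqrt (1 - t) \<le> 1" "sqrt t \<le> 1" using t by auto
      then have "4 * (sqrt (1 - t) + sqrt t) \<le> 4 * (1 + 1)"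
        by (intro mult_left_mono add_mono) auto
      then show ?thesis
        unfolding C_def using \<open>c > 0\<close> by (intro ennreal_leI divide_right_mono) simp_all
    qed
    finally show ?thesis .
  qed
  have "(\<integral>\<^sup>+ z. (\<integral>\<^sup>+ w. e2ennreal (log_kernel z w) \<partial>\<mu>) \<partial>\<mu>) \<le> (\<integral>\<^sup>+ z. C \<partial>\<mu>)"
  proof (rule nn_integral_mono_AE)
    have "AE z in \<mu>. z \<in> K"
    proof -
      have "AE t in L. \<gamma> t \<in> K" by (rule AE_I2) (auto simp: K_def spL)
      then show ?thesis unfolding \<mu>_def by (subst AE_distr_iff) auto
    qed
    then show "AE z in \<mu>. (\<integral>\<^sup>+ w. e2ennreal (log_kernel z w) \<partial>\<mu>) \<le> C"
      by (rule AE_mp) (use inner in auto)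
  qed
  also have "\<dots> = C" using prob by (simp add: compactly_supported_probs_def)
  finally have "(\<integral>\<^sup>+ z. (\<integral>\<^sup>+ w. e2ennreal (log_kernel z w) \<partial>\<mu>) \<partial>\<mu>) \<le> C" .
  then have "log_energy \<mu> \<le> enn2ereal C"
    unfolding log_energy_def by (intro ereal_diff_le_mono_left) (simp_all add: less_eq_ennreal.rep_eq)
  then have "robin_constant E \<le> enn2ereal C"
    unfolding robin_constant_def using prob by (meson INF_lower order_trans)
  then have "robin_constant E \<noteq> \<infinity>"
    using \<open>c > 0\<close> by (auto simp: C_def enn2ereal_ennreal)
  then show ?thesis by (simp add: log_capacity_def)
qed

section \<open>Green's function of a level set\<close>

text \<open>
  Locally \<open>ln (cmod f)\<close> is the real part of a logarithm of \<open>f\<close>. Its gradient is therefore read off from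
  the single-valued holomorphic function \<open>h = a * f' / f\<close>: the partial derivatives of \<open>u\<close> are \<open>Re h\<close> and
  \<open>- Im h\<close>, and the Cauchy-Riemann equations of \<open>h\<close> are Laplace's equation for \<open>u\<close>.
\<close>

lemma harmonic_on_ln_cmod_holomorphic:
  assumes S: "open S" and f: "f holomorphic_on S" and nz: "\<And>z. z \<in> S \<Longrightarrow> f z \<noteq> 0"
    and u: "\<And>z. z \<in> S \<Longrightarrow> u z = a * ln (cmod (f z)) + b"
  shows "harmonic_on u S"
proof -
  define h where "h z = of_real a * deriv f z / f z" for z
  have h: "h holomorphic_on S"
    unfolding h_def using assms by (intro holomorphic_intros holomorphic_deriv) auto
  then have h': "deriv h holomorphic_on S" using S by (rule holomorphic_deriv)
  have dh: "(h has_derivative (\<lambda>w. deriv h z * w)) (at z)" if "z \<in> S" for z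
    using holomorphic_derivI[OF h S that] by (simp add: has_field_derivative_def)
  have du: "(u has_derivative (\<lambda>w. Re (h z * w))) (at z)" if z: "z \<in> S" for z
  proof -
    define w0 where "w0 = f z"
    have w0: "w0 \<noteq> 0" using nz[OF z] by (simp add: w0_def)
    have df: "(f has_derivative (\<lambda>w. deriv f z * w)) (at z)"
      using holomorphic_derivI[OF f S z] by (simp add: has_field_derivative_def)
    have "((\<lambda>z. a * ln (norm (f z)) + b) has_derivative
             (\<lambda>w. a * (inverse (norm (f z)) * ((deriv f z * w) \<bullet> sgn (f z))))) (at z)"
      using w0 unfolding w0_def
      by (auto intro!: derivative_eq_intros df has_derivative_norm[THEN has_derivative_compose[OF df]]
          simp: field_simps)
    moreover have "a * (inverse (norm (f z)) * ((deriv f z * w) \<bullet> sgn (f z))) = Re (h z * w)" for w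
    proof -
      have "inverse (norm w0) * (x \<bullet> sgn w0) = Re (x / w0)" for x
        by (simp add: complex_div_cnj[of x] sgn_div_norm inner_complex_def power2_eq_square add_divide_distrib
            field_simps flip: of_real_mult)
      then have "a * (inverse (norm (f z)) * ((deriv f z * w) \<bullet> sgn (f z))) = a * Re (deriv f z * w / f z)"
        by (simp add: w0_def)
      also have "\<dots> = Re (of_real a * (deriv f z * w / f z))"
      proof -
        have "a * Re x = Re (of_real a * x)" for x by simp
        then show ?thesis .
      qed
      also have "\<dots> = Re (h z * w)" by (simp add: h_def mult.assoc)
      finally show ?thesis .
    qed
    ultimately have "((\<lambda>z. a * ln (norm (f z)) + b) has_derivative (\<lambda>w. Re (h z * w))) (at z)" by simp
    then show ?thesis
      by (rule has_derivative_transform_within_open[OF _ S z]) (simp add: u)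
  qed
  show ?thesis
    unfolding harmonic_on_def
  proof (intro conjI exI ballI)
    fix z assume z: "z \<in> S"
    show "(u has_derivative (\<lambda>w. Re (h z) * Re w + - Im (h z) * Im w)) (at z)"
      using du[OF z] by simp
    show "((\<lambda>z. Re (h z)) has_derivative (\<lambda>w. Re (deriv h z) * Re w + - Im (deriv h z) * Im w)) (at z)"
      using has_derivative_Re[OF dh[OF z]] by simp
    show "((\<lambda>z. - Im (h z)) has_derivative (\<lambda>w. - Im (deriv h z) * Re w + - Re (deriv h z) * Im w)) (at z)"
      using has_derivative_minus[OF has_derivative_Im[OF dh[OF z]]] by (simp add: algebra_simps)
    show "Re (deriv h z) + - Re (deriv h z) = 0" by simp
  qed (intro S continuous_intros holomorphic_on_imp_continuous_on[OF h'])+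
qed

text \<open>
  On the boundary of a bounded component of \<open>{z. \<delta> < cmod (f z)}\<close> the modulus of \<open>f\<close> is at most \<open>\<delta>\<close>; by
  the maximum principle this would persist inside. So all components are unbounded.
\<close>

lemma outside_lemniscate_disc:
  assumes f: "f holomorphic_on UNIV"
  shows "outside {z. cmod (f z) \<le> \<delta>} = {z. \<delta> < cmod (f z)}"
proof -
  let ?E = "{z. cmod (f z) \<le> \<delta>}"
  have cont: "continuous_on UNIV f" using f by (rule holomorphic_on_imp_continuous_on)
  then have closed: "closed ?E" by (intro closed_Collect_le continuous_intros) 
  have "\<not> bounded (connected_component_set (- ?E) x)" if x: "\<delta> < cmod (f x)" for x
  proof
    let ?U = "connected_component_set (- ?E) x"
    assume bdd: "bounded ?U"
    have "cmod (f z) \<le> \<delta>" if "z \<in> frontier ?U" for z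
      using frontier_of_components_closed_complement[OF closed, of ?U] that x
      by (auto simp: components_iff linorder_not_le)
    then have "cmod (f x) \<le> \<delta>"
    proof (rule maximum_modulus_frontier[OF _ _ bdd, rotated 2])
      show "x \<in> ?U" using x by simp
      show "f holomorphic_on interior ?U" using f by (rule holomorphic_on_subset) simp
      show "continuous_on (closure ?U) f" using cont by (rule continuous_on_subset) simp
    qed
    with x show False by simp
  qed
  then show ?thesis by (auto simp: outside_def)
qed

lemma outside_unit_circle: "outside {z::complex. cmod z = 1} = {z. 1 < cmod z}"
proof -
  have "{z::complex. cmod z = 1} = frontier (cball 0 1)" by (auto simp: frontier_cball)
  then have "outside {z::complex. cmod z = 1} = - closure (cball 0 1)"
    using outside_frontier_eq_complement_closure[of "cball (0::complex) 1"] by simp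
  then show ?thesis by auto
qed

text \<open>
  The maximum with 1 extends \<open>a * ln (cmod (f z) / \<delta>)\<close> continuously by zero across the level curve,
  so the exceptional polar set is empty. The factor \<open>a\<close>, the reciprocal of the degree if \<open>f\<close> is a
  polynomial, enters through the growth condition only.
\<close>

lemma green_function_log_modulus:
  assumes f: "f holomorphic_on UNIV" and "\<delta> > 0"
    and E: "compact E" "log_capacity E > 0" and out: "outside E = {z. \<delta> < cmod (f z)}"
    and growth: "(\<lambda>z. a * ln (cmod (f z) / \<delta>) - ln (cmod z)) \<in> O[at_infinity](\<lambda>_. 1)"
  shows "green_function E (\<lambda>z. a * ln (max 1 (cmod (f z) / \<delta>)))"
proof -
  let ?g = "\<lambda>z. a * ln (max 1 (cmod (f z) / \<delta>))"
  have contf: "continuous_on UNIV f" using f by (rule holomorphic_on_imp_continuous_on)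
  have cont: "continuous_on UNIV ?g"
    by (intro continuous_intros contf) (use \<open>\<delta> > 0\<close> in auto)
  have g_out: "?g z = a * ln (cmod (f z) / \<delta>)" if "z \<in> outside E" for z
    using that \<open>\<delta> > 0\<close> by (simp add: out max_def)
  have "harmonic_on ?g (outside E)"
  proof (rule harmonic_on_ln_cmod_holomorphic)
    show "open (outside E)"
      using E(1) by (simp add: compact_imp_closed open_outside)
    show "?g z = a * ln (cmod (f z)) + (- a * ln \<delta>)" if "z \<in> outside E" for z
    proof -
      have "ln (cmod (f z) / \<delta>) = ln (cmod (f z)) - ln \<delta>"
        using that \<open>\<delta> > 0\<close> by (subst ln_div) (auto simp: out)
      then show ?thesis unfolding g_out[OF that] by (simp add: right_diff_distrib)
    qed
  qed (use f \<open>\<delta> > 0\<close> in \<open>auto simp: out intro: holomorphic_on_subset\<close>)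
  moreover have "(\<lambda>z. ?g z - ln (cmod z)) \<in> O[at_infinity](\<lambda>_. 1)"
  proof -
    obtain R where R: "\<And>z. z \<in> - outside E \<Longrightarrow> cmod z \<le> R"
      using cobounded_outside[OF compact_imp_bounded[OF E(1)]] by (auto simp: bounded_iff)
    have "\<forall>\<^sub>F z in at_infinity. ?g z - ln (cmod z) = a * ln (cmod (f z) / \<delta>) - ln (cmod z)"
      unfolding eventually_at_infinity
    proof (intro exI[of _ "R + 1"] allI impI)
      fix z :: complex assume "R + 1 \<le> cmod z"
      with R[of z] have "z \<in> outside E" by auto
      with g_out[of z] show "?g z - ln (cmod z) = a * ln (cmod (f z) / \<delta>) - ln (cmod z)" by simp
    qed
    from landau_o.big.in_cong[OF this] growth show ?thesis by simp
  qed
  moreover have "?g z = 0" if "z \<notin> outside E" for z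
    using that \<open>\<delta> > 0\<close> by (simp add: out max_def field_simps)
  moreover have "bounded (?g ` cball 0 R)" for R
    using cont by (intro compact_imp_bounded compact_continuous_image) (auto intro: continuous_on_subset)
  moreover have "isCont ?g z" for z
    using cont by (simp add: continuous_on_eq_continuous_at)
  ultimately show ?thesis
    unfolding green_function_def using E polar_empty by (intro conjI allI impI exI[of _ "{}"]) auto
qed

lemma green_function_unit_circle: "green_function {z. cmod z = 1} (\<lambda>z. ln (max 1 (cmod z)))"
proof -
  have "log_capacity {z. cmod z = 1} > 0"
  proof (rule log_capacity_pos_expanding_arc)
    \<comment> \<open>A quarter of the circle, parametrized by its real part.\<close>
    let ?\<gamma> = "\<lambda>t. Complex t (sqrt (1 - t\<^sup>2))"
    show "continuous_on {0..1} ?\<gamma>"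
      by (simp add: complex_eq continuous_intros Complex_eq)
    show "?\<gamma> ` {0..1} \<subseteq> {z. cmod z = 1}"
      by (auto simp: cmod_def power_le_one)
    show "1 * \<bar>t - s\<bar> \<le> cmod (?\<gamma> t - ?\<gamma> s)" for s t
      using abs_Re_le_cmod[of "?\<gamma> t - ?\<gamma> s"] by simp
  qed simp
  moreover have "compact {z::complex. cmod z = 1}"
    using compact_sphere[of "0::complex" 1] by (simp add: sphere_def)
  ultimately show ?thesis
    using green_function_log_modulus[of "\<lambda>z. z" 1 "{z. cmod z = 1}" 1]
    by (simp add: outside_unit_circle)
qed

section \<open>Lemniscates around the roots of unity\<close>

text \<open>
  For small \<open>\<delta>\<close> this is a union of \<open>N\<close> almost round continua of radius about \<open>\<delta> / N\<close>, one around each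
  \<open>N\<close>-th root of unity. Being the preimage of a disc under a polynomial, it has an explicit Green's
  function.
\<close>

definition unity_lemniscate :: "nat \<Rightarrow> real \<Rightarrow> complex set" where
  "unity_lemniscate N \<delta> = {z. cmod (z ^ N - 1) \<le> \<delta>}"

lemma closed_unity_lemniscate: "closed (unity_lemniscate N \<delta>)"
  unfolding unity_lemniscate_def by (intro closed_Collect_le continuous_intros)

lemma cmod_power_bounds:
  assumes "z \<in> unity_lemniscate N \<delta>"
  shows "1 - \<delta> \<le> cmod z ^ N" "cmod z ^ N \<le> 1 + \<delta>"
  using assms norm_triangle_ineq2[of "z ^ N" 1] norm_triangle_ineq2[of 1 "z ^ N"]
  by (auto simp: unity_lemniscate_def norm_power norm_minus_commute)

lemma unity_lemniscate_subset_cball: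
  assumes "N > 0" "\<delta> \<le> 1"
  shows "unity_lemniscate N \<delta> \<subseteq> cball 0 2"
proof
  fix z assume z: "z \<in> unity_lemniscate N \<delta>"
  have "cmod z ^ N \<le> 2" using cmod_power_bounds(2)[OF z] assms by simp
  also have "2 \<le> (2::real) ^ N" using assms self_le_power[of "2::real" N] by simp
  finally show "z \<in> cball 0 2"
    using assms by (simp add: power_mono_iff)
qed

lemma compact_unity_lemniscate:
  assumes "N > 0" "\<delta> \<le> 1"
  shows "compact (unity_lemniscate N \<delta>)"
  using closed_unity_lemniscate unity_lemniscate_subset_cball[OF assms] bounded_subset[OF bounded_cball]
  by (auto simp: compact_eq_bounded_closed)

text \<open>
  The Lipschitz bound \<open>N * M ^ (N - 1)\<close> for the \<open>N\<close>-th power on the disc of radius \<open>M\<close>, multiplied by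
  \<open>M\<close> to avoid the subtraction in the exponent.
\<close>

lemma norm_power_diff_le:
  fixes z w :: complex
  assumes "M > 0" "cmod z \<le> M" "cmod w \<le> M"
  shows "cmod (z ^ N - w ^ N) * M \<le> M ^ N * (real N * cmod (z - w))"
proof -
  have "cmod ((z / of_real M) ^ N - (w / of_real M) ^ N) \<le> N * cmod (z / of_real M - w / of_real M)"
    using assms by (intro norm_power_diff) (auto simp: norm_divide)
  then have "cmod (z ^ N - w ^ N) / M ^ N \<le> N * (cmod (z - w) / M)"
    using assms by (simp add: power_divide norm_divide norm_power flip: diff_divide_distrib)
  then show ?thesis using assms by (simp add: field_simps)
qed

text \<open>
  The component of the lemniscate containing \<open>a\<close> has size comparable to \<open>\<delta> / N\<close>. In the disc with
  centre 1 and radius \<open>\<delta>\<close> there is a segment of length at least \<open>\<delta>\<close> starting at \<open>a ^ N\<close>; a branch of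
  the \<open>N\<close>-th root lifts it to a path \<open>Z\<close> from \<open>a\<close> within the lemniscate. The \<open>N\<close>-th power expands
  distances by a factor of at most \<open>2 * N\<close> there, so \<open>Z\<close> ends at distance at least \<open>\<delta> / (2 * N)\<close> from
  \<open>a\<close>, and the intermediate value theorem gives the smaller distances.
\<close>

lemma unity_lemniscate_meets_circle:
  assumes N: "N > 0" and \<delta>: "0 < \<delta>" "\<delta> \<le> 1 / 4" and a: "a \<in> unity_lemniscate N \<delta>"
    and s: "0 \<le> s" "s \<le> \<delta> / (2 * real N)"
  shows "\<exists>z \<in> unity_lemniscate N \<delta>. cmod (z - a) = s"
proof -
  define w where "w = a ^ N"
  have w: "cmod (w - 1) \<le> \<delta>" using a by (simp add: w_def unity_lemniscate_def)
  have cw: "cmod w \<ge> 3 / 4" using cmod_power_bounds(1)[OF a] \<delta> by (simp add: w_def norm_power)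
  have w0: "w \<noteq> 0" using cw by auto
  \<comment> \<open>The endpoints of the real diameter of the disc are \<open>2 * \<delta>\<close> apart, so one of them is far from \<open>w\<close>.\<close>
  have "2 * \<delta> \<le> cmod (w - of_real (1 + \<delta>)) + cmod (w - of_real (1 - \<delta>))"
  proof -
    have "(w - of_real (1 - \<delta>)) - (w - of_real (1 + \<delta>)) = of_real (2 * \<delta>)" by simp
    then have "cmod ((w - of_real (1 - \<delta>)) - (w - of_real (1 + \<delta>))) = 2 * \<delta>"
      using \<delta> by (simp only: norm_of_real)
    then show ?thesis
      using norm_triangle_ineq4[of "w - of_real (1 - \<delta>)" "w - of_real (1 + \<delta>)"] by linarith
  qed
  then obtain w' where w': "\<delta> \<le> cmod (w' - w)" "cmod (w' - 1) \<le> \<delta>"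
  proof (cases "\<delta> \<le> cmod (w - of_real (1 + \<delta>))")
    case True
    then show ?thesis using that[of "of_real (1 + \<delta>)"] \<delta> by (simp add: norm_minus_commute)
  next
    case False
    with \<open>2 * \<delta> \<le> _\<close> have "\<delta> \<le> cmod (w - of_real (1 - \<delta>))" by linarith
    then show ?thesis using that[of "of_real (1 - \<delta>)"] \<delta> by (simp add: norm_minus_commute)
  qed
  define p where "p t = w + of_real t * (w' - w)" for t
  have p: "cmod (p t - 1) \<le> \<delta>" if "t \<in> {0..1}" for t
  proof -
    have "p t \<in> closed_segment w w'"
      using that by (auto simp: p_def in_segment scaleR_conv_of_real algebra_simps)
    moreover have "closed_segment w w' \<subseteq> cball 1 \<delta>"
      using w w' by (intro closed_segment_subset) (auto simp: dist_norm norm_minus_commute)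
    ultimately show ?thesis by (auto simp: dist_norm norm_minus_commute)
  qed
  \<comment> \<open>This keeps \<open>p t / w\<close> away from the branch cut of \<open>Ln\<close>; here \<open>\<delta> \<le> 1 / 4\<close> is used.\<close>
  have pw: "Re (p t / w) > 0" if "t \<in> {0..1}" for t
  proof -
    have "cmod (p t - w) \<le> 2 * \<delta>"
      using norm_triangle_ineq4[of "p t - 1" "w - 1"] p[OF that] w by simp
    moreover have "p t / w - 1 = (p t - w) / w" using w0 by (simp add: field_simps)
    ultimately have "cmod (p t / w - 1) \<le> 2 * \<delta> / cmod w"
      by (simp add: norm_divide divide_right_mono)
    also have "\<dots> < 1" using cw \<delta> by (subst divide_less_eq_1_pos) linarith+
    finally have "cmod (p t / w - 1) < 1" .
    with abs_Re_le_cmod[of "p t / w - 1"] show ?thesis by simp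
  qed
  define Z where "Z t = a * exp (Ln (p t / w) / of_nat N)" for t
  have Zpow: "Z t ^ N = p t" if "t \<in> {0..1}" for t
  proof -
    have "p t / w \<noteq> 0" using pw[OF that] by force
    then show ?thesis
      using N w0 by (simp add: Z_def power_mult_distrib exp_of_nat_mult[symmetric] w_def)
  qed
  have Zin: "Z t \<in> unity_lemniscate N \<delta>" if "t \<in> {0..1}" for t
    using Zpow[OF that] p[OF that] by (simp add: unity_lemniscate_def)
  have "continuous_on {0..1} (\<lambda>t. cmod (Z t - a))"
    unfolding Z_def p_def
  proof (intro continuous_intros)
    fix t :: real assume "t \<in> {0..1}"
    from pw[OF this] show "(w + of_real t * (w' - w)) / w \<notin> \<real>\<^sub>\<le>\<^sub>0"
      by (auto simp: p_def complex_nonpos_Reals_iff)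
  qed (use N w0 in auto)
  moreover have "cmod (Z 0 - a) \<le> s" using s w0 by (simp add: Z_def p_def)
  moreover have "s \<le> cmod (Z 1 - a)"
  proof -
    \<comment> \<open>All points of the lemniscate satisfy \<open>cmod z ^ N \<le> 1 + \<delta> \<le> 5 / 4\<close>.\<close>
    define M where "M = root N (5 / 4)"
    have MN: "M ^ N = 5 / 4" and M: "M \<ge> 1" using N by (auto simp: M_def)
    have le: "cmod z \<le> M" if "z \<in> unity_lemniscate N \<delta>" for z
    proof -
      have "cmod z ^ N \<le> M ^ N" using cmod_power_bounds(2)[OF that] \<delta> MN by linarith
      then show ?thesis using N M by (subst (asm) power_mono_iff) auto
    qed
    have "\<delta> \<le> cmod (Z 1 ^ N - a ^ N)"
      using w' Zpow[of 1] by (simp add: p_def w_def)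
    also have "\<dots> \<le> cmod (Z 1 ^ N - a ^ N) * M" using mult_left_mono[OF M norm_ge_zero[of "Z 1 ^ N - a ^ N"]] by simp
    also have "\<dots> \<le> M ^ N * (real N * cmod (Z 1 - a))"
      using M le Zin[of 1] a by (intro norm_power_diff_le) auto
    also have "\<dots> \<le> 2 * real N * cmod (Z 1 - a)"
      unfolding MN by (simp add: mult_right_mono)
    finally have "\<delta> / (2 * real N) \<le> cmod (Z 1 - a)"
      using N by (simp add: field_simps)
    with s show ?thesis by linarith
  qed
  ultimately obtain t where "t \<in> {0..1}" "cmod (Z t - a) = s"
    using IVT'[of "\<lambda>t. cmod (Z t - a)" 0 s 1] by auto
  then show ?thesis using Zin by auto
qed

text \<open>
  Radii up to \<open>\<delta> / (2 * N)\<close> are attained as distances from \<open>a\<close>. For larger \<open>r\<close>, which is at most 4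
  because the lemniscate lies in the disc of radius 2, a point at distance \<open>\<delta> / (2 * N)\<close> still lies in
  the annulus.
\<close>

lemma uniformly_perfect_unity_lemniscate:
  assumes N: "N > 0" and \<delta>: "0 < \<delta>" "\<delta> \<le> 1 / 4"
  shows "uniformly_perfect (\<delta> / (8 * real N)) (unity_lemniscate N \<delta>)"
proof -
  let ?E = "unity_lemniscate N \<delta>" and ?\<alpha> = "\<delta> / (8 * real N)"
  have sub: "?E \<subseteq> cball 0 2" using N \<delta> by (intro unity_lemniscate_subset_cball) auto
  have \<alpha>: "0 < ?\<alpha>" "?\<alpha> < 1" using N \<delta> by (auto simp: field_simps)
  have "?E \<inter> {z. ?\<alpha> * r \<le> cmod (z - a) \<and> cmod (z - a) \<le> r} \<noteq> {}"
    if a: "a \<in> ?E" and r: "0 < r" "bounded ?E \<longrightarrow> r \<le> diameter ?E" for a r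
  proof -
    have "r \<le> 4"
      using diameter_subset[OF sub] bounded_subset[OF bounded_cball sub] r by (auto simp: diameter_cball)
    define s where "s = min r (\<delta> / (2 * real N))"
    obtain z where z: "z \<in> ?E" "cmod (z - a) = s"
      using unity_lemniscate_meets_circle[OF N \<delta> a, of s] r N \<delta> by (auto simp: s_def)
    have "?\<alpha> * r \<le> ?\<alpha> * 4" using \<alpha> \<open>r \<le> 4\<close> by (intro mult_left_mono) auto
    moreover have "?\<alpha> * r \<le> 1 * r" using \<alpha> r by (intro mult_right_mono) auto
    ultimately have "?\<alpha> * r \<le> s" by (simp add: s_def)
    with z show ?thesis by (auto simp: s_def)
  qed
  then show ?thesis
    unfolding uniformly_perfect_def using \<alpha> closed_unity_lemniscate by blast
qed

lemma log_capacity_unity_lemniscate_pos: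
  assumes "N > 0" "0 < \<delta>"
  shows "log_capacity (unity_lemniscate N \<delta>) > 0"
proof -
  have "open ((\<lambda>z::complex. z ^ N - 1) -` ball 0 \<delta>)"
    by (intro continuous_open_vimage continuous_intros) auto
  moreover have "(1::complex) \<in> (\<lambda>z. z ^ N - 1) -` ball 0 \<delta>" using assms by simp
  ultimately obtain \<rho> where \<rho>: "\<rho> > 0" "cball (1::complex) \<rho> \<subseteq> (\<lambda>z. z ^ N - 1) -` ball 0 \<delta>"
    by (meson open_contains_cball)
  show ?thesis
  proof (rule log_capacity_pos_expanding_arc)
    \<comment> \<open>A short segment at the root of unity 1.\<close>
    let ?\<gamma> = "\<lambda>t. 1 + of_real (\<rho> * t) :: complex"
    show "continuous_on {0..1} ?\<gamma>" by (intro continuous_intros)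
    have "?\<gamma> t \<in> cball 1 \<rho>" if "t \<in> {0..1}" for t
      using that \<rho> by (simp add: dist_norm norm_mult mult_left_le)
    with \<rho> show "?\<gamma> ` {0..1} \<subseteq> unity_lemniscate N \<delta>"
      by (force simp: unity_lemniscate_def)
    show "\<rho> * \<bar>t - s\<bar> \<le> cmod (?\<gamma> t - ?\<gamma> s)" for s t
    proof -
      have "?\<gamma> t - ?\<gamma> s = of_real (\<rho> * (t - s))" by (simp add: algebra_simps)
      then show ?thesis using \<rho> by (simp only: norm_of_real)
    qed
  qed (use \<rho> in auto)
qed

text \<open>
  For \<open>cmod z \<ge> 2\<close> the quotient of \<open>cmod (z ^ N - 1)\<close> and \<open>cmod z ^ N\<close> lies between \<open>1 / 2\<close> and 2, which
  gives the growth condition with \<open>a = 1 / N\<close>.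
\<close>

lemma green_function_unity_lemniscate:
  assumes N: "N > 0" and \<delta>: "0 < \<delta>" "\<delta> \<le> 1"
  shows "green_function (unity_lemniscate N \<delta>) (\<lambda>z. 1 / real N * ln (max 1 (cmod (z ^ N - 1) / \<delta>)))"
proof (rule green_function_log_modulus)
  show "outside (unity_lemniscate N \<delta>) = {z. \<delta> < cmod (z ^ N - 1)}"
    unfolding unity_lemniscate_def by (intro outside_lemniscate_disc holomorphic_intros)
  have "norm (1 / real N * ln (cmod (z ^ N - 1) / \<delta>) - ln (cmod z)) \<le> ln 2 + \<bar>ln \<delta>\<bar>"
    if z: "2 \<le> cmod z" for z
  proof -
    define x where "x = cmod z ^ N"
    define y where "y = cmod (z ^ N - 1)"
    have "2 \<le> (2::real) ^ N" using N self_le_power[of "2::real" N] by simp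
    also have "\<dots> \<le> x" unfolding x_def using z by (intro power_mono) auto
    finally have x: "2 \<le> x" .
    have "x - 1 \<le> y" "y \<le> x + 1"
      using norm_triangle_ineq2[of "z ^ N" 1] norm_triangle_ineq4[of "z ^ N" 1]
      by (auto simp: x_def y_def norm_power)
    then have "1 / 2 \<le> y / x" "y / x \<le> 2" "y > 0" using x by (auto simp: field_simps)
    then have "ln (1 / 2) \<le> ln (y / x)" "ln (y / x) \<le> ln 2" using x by (auto simp del: ln_div)
    then have "\<bar>ln y - ln x\<bar> \<le> ln 2" using x \<open>y > 0\<close> by (auto simp: ln_div)
    then have "\<bar>ln y - ln \<delta> - ln x\<bar> \<le> ln 2 + \<bar>ln \<delta>\<bar>" by linarith
    moreover have "1 / real N * ln (y / \<delta>) - ln (cmod z) = (ln y - ln \<delta> - ln x) / real N"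
    proof -
      have "ln x = real N * ln (cmod z)" using z by (simp add: x_def ln_realpow)
      then show ?thesis using N \<open>y > 0\<close> \<delta> by (simp add: ln_div field_simps)
    qed
    moreover have "b / real N \<le> b" if "b \<ge> 0" for b
      using divide_left_mono[of 1 "real N" b] that N by simp
    ultimately show ?thesis
      unfolding y_def[symmetric] by (simp add: order_trans[OF _ \<open>_ \<le> ln 2 + \<bar>ln \<delta>\<bar>\<close>])
  qed
  then show "(\<lambda>z. 1 / real N * ln (cmod (z ^ N - 1) / \<delta>) - ln (cmod z)) \<in> O[at_infinity](\<lambda>_. 1)"
    by (intro bigoI[where c = "ln 2 + \<bar>ln \<delta>\<bar>"]) (auto simp: eventually_at_infinity)
qed (use assms in \<open>auto intro: compact_unity_lemniscate log_capacity_unity_lemniscate_pos intro!: holomorphic_intros\<close>)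

section \<open>Hausdorff distance from the unit circle\<close>

text \<open>
  The suprema are taken in the reals and are meaningful only for bounded sets of distances; this is
  where compactness enters.
\<close>

lemma hausdorff_distance_nonneg:
  assumes "A \<noteq> {}" "compact A"
  shows "0 \<le> hausdorff_distance A B"
proof -
  obtain a where "a \<in> A" using assms by auto
  have "bounded ((\<lambda>z. infdist z B) ` A)"
    using assms(2) by (intro compact_imp_bounded compact_continuous_image continuous_intros)
  then have "infdist a B \<le> (SUP z\<in>A. infdist z B)"
    using \<open>a \<in> A\<close> by (intro cSUP_upper bounded_imp_bdd_above)
  then show ?thesis
    using infdist_nonneg[of a B] by (simp add: hausdorff_distance_def)
qed

text \<open>The distance from \<open>z\<close> to its radial projection is \<open>\<bar>cmod z - 1\<bar>\<close>, which only grows under powers.\<close>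

lemma infdist_unit_circle_le:
  assumes "N > 0" "z \<noteq> 0"
  shows "infdist z {z. cmod z = 1} \<le> cmod (z ^ N - 1)"
proof -
  have pow: "\<bar>x - 1\<bar> \<le> \<bar>x ^ N - 1\<bar>" if "x \<ge> 0" for x :: real
  proof (cases "x \<ge> 1")
    case True
    then show ?thesis using self_le_power[of x N] assms by simp
  next
    case False
    then show ?thesis using power_decreasing[of 1 N x] that assms by simp
  qed
  have "dist z (sgn z) = \<bar>cmod z - 1\<bar>"
  proof -
    have "z - sgn z = of_real (cmod z - 1) * sgn z"
      using assms by (simp add: sgn_eq field_simps)
    then have "cmod (z - sgn z) = \<bar>cmod z - 1\<bar> * cmod (sgn z)"
      by (simp only: norm_mult norm_of_real)
    then show ?thesis using assms by (simp add: dist_norm norm_sgn)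
  qed
  then have "infdist z {z. cmod z = 1} \<le> \<bar>cmod z - 1\<bar>"
    using infdist_le[of "sgn z" "{z. cmod z = 1}" z] assms by (simp add: norm_sgn)
  also have "\<dots> \<le> \<bar>cmod z ^ N - 1\<bar>" by (rule pow) simp
  also have "\<dots> \<le> cmod (z ^ N - 1)"
    using norm_triangle_ineq3[of "z ^ N" 1] by (simp add: norm_power)
  finally show ?thesis .
qed

text \<open>
  The argument of \<open>z\<close> is rounded down to a multiple of \<open>2 * pi / N\<close>. The chord is shorter than the arc,
  and \<open>2 * pi < 7\<close>.
\<close>

lemma root_of_unity_near:
  assumes N: "N > 0" and z: "cmod z = 1"
  shows "\<exists>w. w ^ N = 1 \<and> dist z w \<le> 7 / real N"
proof -
  define k where "k = \<lfloor>Arg z * real N / (2 * pi)\<rfloor>"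
  define \<phi> where "\<phi> = 2 * pi * of_int k / real N"
  have "cis \<phi> ^ N = cis (2 * pi * of_int k)"
  proof -
    have "real N * \<phi> = 2 * pi * of_int k" using N by (simp add: \<phi>_def)
    then show ?thesis by (simp only: Complex.DeMoivre)
  qed
  also have "\<dots> = 1" by (simp add: cis_multiple_2pi)
  finally have "cis \<phi> ^ N = 1" .
  moreover have "dist z (cis \<phi>) \<le> 7 / real N"
  proof -
    have zc: "z = cis (Arg z)" using z by (metis cis_Arg sgn_eq div_by_1 norm_zero of_real_1 zero_neq_one)
    have "real_of_int k \<le> Arg z * real N / (2 * pi)" "Arg z * real N / (2 * pi) \<le> real_of_int k + 1"
      unfolding k_def by linarith+
    then have "\<phi> \<le> Arg z" "Arg z \<le> \<phi> + 2 * pi / real N"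
      using N by (auto simp: \<phi>_def field_simps)
    moreover have "2 * pi / real N \<le> 7 / real N"
      using pi_less_4 pi_approx N by (intro divide_right_mono) auto
    ultimately have d: "\<bar>Arg z - \<phi>\<bar> \<le> 7 / real N" by linarith
    have "cis (Arg z) - cis \<phi> = cis \<phi> * (cis (Arg z - \<phi>) - 1)"
      by (simp add: right_diff_distrib cis_mult)
    then have "dist z (cis \<phi>) = 2 * \<bar>sin ((Arg z - \<phi>) / 2)\<bar>"
      by (subst zc) (simp only: dist_norm norm_mult norm_cis mult_1 cis_conv_exp[of "Arg z - \<phi>"] dist_exp_i_1)
    also have "\<dots> \<le> \<bar>Arg z - \<phi>\<bar>"
      using abs_sin_x_le_abs_x[of "(Arg z - \<phi>) / 2"] by simp
    finally show ?thesis using d by linarith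
  qed
  ultimately show ?thesis by blast
qed

lemma hausdorff_distance_unity_lemniscate_le:
  assumes N: "N > 0" and \<delta>: "0 < \<delta>" "\<delta> < 1" "\<delta> \<le> 7 / real N"
  shows "hausdorff_distance (unity_lemniscate N \<delta>) {z. cmod z = 1} \<le> 7 / real N"
  unfolding hausdorff_distance_def
proof (intro max.boundedI cSUP_least)
  show "unity_lemniscate N \<delta> \<noteq> {}" using \<delta> by (auto simp: unity_lemniscate_def intro!: exI[of _ 1])
  show "{z::complex. cmod z = 1} \<noteq> {}" by (auto intro: exI[of _ 1])
next
  fix z assume z: "z \<in> unity_lemniscate N \<delta>"
  then have "z \<noteq> 0" using N \<delta> by (auto simp: unity_lemniscate_def power_0_left)
  from infdist_unit_circle_le[OF N this] z \<delta> show "infdist z {z. cmod z = 1} \<le> 7 / real N"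
    by (simp add: unity_lemniscate_def)
next
  fix z :: complex assume "z \<in> {z. cmod z = 1}"
  then obtain w where w: "w ^ N = 1" "dist z w \<le> 7 / real N" using root_of_unity_near[OF N] by auto
  then have "w \<in> unity_lemniscate N \<delta>" using \<delta> by (simp add: unity_lemniscate_def)
  then show "infdist z (unity_lemniscate N \<delta>) \<le> 7 / real N" using w(2) by (rule infdist_le2)
qed

section \<open>Failure of convergence\<close>

theorem proposition4p1:
  shows "\<exists>(\<alpha> :: nat \<Rightarrow> real) (E :: nat \<Rightarrow> complex set)
          (g :: nat \<Rightarrow> complex \<Rightarrow> real) (g\<^sub>T :: complex \<Rightarrow> real).
      (\<forall>n. 0 < \<alpha> n \<and> \<alpha> n < 1) \<and>
      (\<forall>n. E n \<noteq> {} \<and> compact (E n) \<and> uniformly_perfect (\<alpha> n) (E n)) \<and>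
      (\<lambda>n. hausdorff_distance (E n) {z. cmod z = 1}) \<longlonglongrightarrow> 0 \<and>
      bounded (range (\<lambda>n. hausdorff_distance (E n) {z. cmod z = 1} * ln (\<alpha> n))) \<and>
      (\<forall>n. green_function (E n) (g n)) \<and>
      green_function {z. cmod z = 1} g\<^sub>T \<and>
      \<not> uniform_limit UNIV g g\<^sub>T sequentially"
proof -
  define \<delta> where "\<delta> n = (1 / 4 :: real) ^ Suc n" for n
  define \<alpha> where "\<alpha> n = \<delta> n / (8 * real (Suc n))" for n
  define E where "E n = unity_lemniscate (Suc n) (\<delta> n)" for n
  define g where "g n z = 1 / real (Suc n) * ln (max 1 (cmod (z ^ Suc n - 1) / \<delta> n))" for n z
  define d where "d n = hausdorff_distance (E n) {z. cmod z = 1}" for n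
  have \<delta>: "0 < \<delta> n" "\<delta> n \<le> 1 / 4" for n
    using power_decreasing[of 1 "Suc n" "1 / 4 :: real"] by (auto simp: \<delta>_def simp del: power_Suc)
  have \<delta>1: "\<delta> n < 1" for n using \<delta>(2)[of n] by linarith
  have compact: "compact (E n)" for n
    unfolding E_def using \<delta>1[of n] by (intro compact_unity_lemniscate) auto
  have ne: "E n \<noteq> {}" for n
    using less_imp_le[OF \<delta>(1)] by (auto simp: E_def unity_lemniscate_def intro!: exI[of _ 1])
  have up: "uniformly_perfect (\<alpha> n) (E n)" for n
    unfolding \<alpha>_def E_def using \<delta> by (intro uniformly_perfect_unity_lemniscate) auto
  then have \<alpha>: "0 < \<alpha> n" "\<alpha> n < 1" for n by (auto simp: uniformly_perfect_def)
  have d0: "0 \<le> d n" for n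
    unfolding d_def using ne compact by (intro hausdorff_distance_nonneg)
  have d7: "d n \<le> 7 / real (Suc n)" for n
    unfolding d_def E_def
  proof (rule hausdorff_distance_unity_lemniscate_le)
    have "real (Suc n) \<le> 2 ^ Suc n" using of_nat_less_two_power[of "Suc n", where 'a = real] by linarith
    also have "\<dots> \<le> 4 ^ Suc n" by (rule power_mono) auto
    finally have "\<delta> n \<le> 1 / real (Suc n)"
      by (simp add: \<delta>_def power_one_over frac_le del: power_Suc of_nat_Suc)
    also have "\<dots> \<le> 7 / real (Suc n)" by (rule divide_right_mono) auto
    finally show "\<delta> n \<le> 7 / real (Suc n)" .
  qed (use \<delta> \<delta>1 in auto)
  have "d \<longlonglongrightarrow> 0"
  proof (rule tendsto_sandwich[of "\<lambda>_. 0" d _ "\<lambda>n. 7 / real (Suc n)"])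
    show "(\<lambda>n. 7 / real (Suc n)) \<longlonglongrightarrow> 0"
      by (intro LIMSEQ_Suc[OF lim_const_over_n])
  qed (use d0 d7 in auto)
  moreover have "bounded (range (\<lambda>n. d n * ln (\<alpha> n)))"
    unfolding bounded_iff
  proof (intro exI[of _ 77] ballI, clarify)
    fix n
    define N where "N = real (Suc n)"
    have N: "N > 0" by (simp add: N_def)
    \<comment> \<open>\<open>- ln (\<alpha> n)\<close> grows linearly in \<open>N\<close>, which matches the bound \<open>7 / N\<close> for the distance.\<close>
    have "- ln (\<alpha> n) = ln (8 * N) + N * ln 4"
      using N by (simp add: \<alpha>_def \<delta>_def ln_div ln_mult ln_realpow N_def del: power_Suc of_nat_Suc)
    moreover have "ln (8 * N) \<le> 8 * N" using N by (intro ln_bound) auto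
    moreover have "N * ln 4 \<le> N * 3" using N ln_le_minus_one[of 4] by (intro mult_left_mono) auto
    moreover have "ln (\<alpha> n) < 0" using \<alpha> by simp
    ultimately have "\<bar>ln (\<alpha> n)\<bar> \<le> 11 * N" by linarith
    then have "\<bar>d n\<bar> * \<bar>ln (\<alpha> n)\<bar> \<le> 7 / N * (11 * N)"
      using d0[of n] d7[of n] N by (intro mult_mono) (auto simp: N_def)
    then show "norm (d n * ln (\<alpha> n)) \<le> 77" using N by (simp add: abs_mult)
  qed
  moreover have "green_function (E n) (g n)" for n
    unfolding E_def g_def using \<delta> \<delta>1 by (intro green_function_unity_lemniscate) (auto intro: less_imp_le)
  moreover have "\<not> uniform_limit UNIV g (\<lambda>z. ln (max 1 (cmod z))) sequentially"
  proof
    assume "uniform_limit UNIV g (\<lambda>z. ln (max 1 (cmod z))) sequentially"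
    then have "(\<lambda>n. g n 0) \<longlonglongrightarrow> 0"
      by (auto dest: tendsto_uniform_limitI[where x = 0])
    \<comment> \<open>With \<open>\<delta> n\<close> an \<open>N\<close>-th power, the factor \<open>1 / N\<close> in Green's function cancels.\<close>
    moreover have "g n 0 = ln 4" for n
    proof -
      have "max 1 (1 / \<delta> n) = 4 ^ Suc n"
        by (simp add: \<delta>_def power_one_over max_def del: power_Suc)
      then show ?thesis
        by (simp add: g_def ln_realpow del: power_Suc of_nat_Suc) 
    qed
    ultimately show False by (simp add: LIMSEQ_const_iff)
  qed
  ultimately show ?thesis
    using \<alpha> ne compact up green_function_unit_circle unfolding d_def by blast
qed

end
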